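(* Let $\tau>0$, $a>0$, $b>0$ be constants. For each $n$ let $H_n$ be an $n\times n$ positive semidefinite (Hermitian) matrix whose eigenvalue $0$ has multiplicity exactly one, with eigenvalues $\lambda_1(H_n)\ge\dots\ge\lambda_{n-1}(H_n)>\lambda_n(H_n)=0$, and assume that for all sufficiently large $n$ one has $\lambda_{n-1}(H_n)=a\log n$ and $\lambda_1(H_n)=b\log n$. Then, as $n\to\infty$: 1. if $\tau<\frac1b$, then $S(\varrho_{H_n}^\tau)\ge(1-\tau b)\log n+o(1)$; 2. if $\tau=\frac1b$, then $S(\varrho_{H_n}^\tau)\ge\log 2+o(1)$; 3. if $\tau>\frac1a$, then $S(\varrho_{H_n}^\tau)=o(1)$.
   Context: For a Hermitian matrix $H$ and real $\tau$, the Gibbs state is $\varrho_H^\tau=\exp(-\tau H)/Z$ with $Z=\mathrm{Tr}(\exp(-\tau H))$. The von Neumann entropy of a density matrix $\varrho$ is $S(\varrho)=-\mathrm{Tr}(\varrho\log\varrho)$, where $\log$ is the natural logarithm. $o(1)$ denotes a sequence (of any sign) converging to $0$; "$f(n)\ge g(n)+o(1)$" means that there is a sequence $\varepsilon_n\to0$ with $f(n)\ge g(n)+\varepsilon_n$ for all sufficiently large $n$. *)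

theory Defs
  imports Complex_Main
    "HOL-Library.Multiset"
    "HOL-Computational_Algebra.Polynomial"
    "Jordan_Normal_Form.Matrix"
    "Jordan_Normal_Form.Char_Poly"
    "Jordan_Normal_Form.Schur_Decomposition"
begin

definition hermitian_mat :: "complex mat \<Rightarrow> bool" where
  "hermitian_mat A \<longleftrightarrow> square_mat A \<and> mat_adjoint A = A"

definition unitary_mat :: "complex mat \<Rightarrow> bool" where
  "unitary_mat U \<longleftrightarrow> square_mat U
     \<and> mat_adjoint U * U = 1\<^sub>m (dim_row U) \<and> U * mat_adjoint U = 1\<^sub>m (dim_row U)"

text \<open>For Hermitian \<open>A\<close> the quadratic form is real, so taking the real part loses nothing.\<close>

definition psd_mat :: "complex mat \<Rightarrow> bool" where
  "psd_mat A \<longleftrightarrow> hermitian_mat A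
     \<and> (\<forall>v \<in> carrier_vec (dim_row A). 0 \<le> Re ((A *\<^sub>v v) \<bullet>c v))"

text \<open>\<open>eigval A k\<close> is the \<open>k\<close>-th largest eigenvalue of a Hermitian matrix, with
  \<open>1 \<le> k \<le> dim_row A\<close>, eigenvalues being counted with multiplicity. The roots of the
  characteristic polynomial of a Hermitian matrix are real, so \<open>Re\<close> only changes their type.\<close>

definition eigval :: "complex mat \<Rightarrow> nat \<Rightarrow> real" where
  "eigval A k =
     rev (sorted_list_of_multiset (image_mset Re (proots (char_poly A)))) ! (k - 1)"

definition mat_trace :: "complex mat \<Rightarrow> complex" where
  "mat_trace A = (\<Sum>i<dim_row A. A $$ (i, i))"

text \<open>The power series of the exponential, summed entrywise since the dimension is not
  part of the type.\<close>

definition mat_exp :: "complex mat \<Rightarrow> complex mat" where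
  "mat_exp A = mat (dim_row A) (dim_row A)
     (\<lambda>(i, j). \<Sum>k. (A ^\<^sub>m k) $$ (i, j) / of_nat (fact k))"

text \<open>The logarithm by the spectral functional calculus; it is independent of the chosen
  diagonalisation by \<open>mat_log_eq\<close> below. On the kernel of the matrix the library's
  convention \<open>ln 0 = 0\<close> applies, which gives \<open>0 log 0 = 0\<close> in the entropy.\<close>

definition mat_log :: "complex mat \<Rightarrow> complex mat" where
  "mat_log A = (THE L. \<exists>n U (d :: nat \<Rightarrow> real).
     U \<in> carrier_mat n n \<and> unitary_mat U
     \<and> A = U * mat_diag n (\<lambda>i. complex_of_real (d i)) * mat_adjoint U
     \<and> L = U * mat_diag n (\<lambda>i. complex_of_real (ln (d i))) * mat_adjoint U)"

definition gibbs_state :: "complex mat \<Rightarrow> real \<Rightarrow> complex mat" where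
  "gibbs_state H \<tau> =
     (1 / mat_trace (mat_exp (complex_of_real (- \<tau>) \<cdot>\<^sub>m H)))
       \<cdot>\<^sub>m mat_exp (complex_of_real (- \<tau>) \<cdot>\<^sub>m H)"

text \<open>For a density matrix the trace below is real.\<close>

definition vn_entropy :: "complex mat \<Rightarrow> real" where
  "vn_entropy \<rho> = - Re (mat_trace (\<rho> * mat_log \<rho>))"

lemma mat_adjoint_carrier:
  assumes "(U :: complex mat) \<in> carrier_mat n n"
  shows "mat_adjoint U \<in> carrier_mat n n"
  using assms by (auto simp: mat_adjoint_def mat_of_rows_def)

lemma unitary_conj_cancel:
  assumes U: "U \<in> carrier_mat n n" "unitary_mat U" and X: "X \<in> carrier_mat n n"
  shows "mat_adjoint U * (U * X) = X" "U * (mat_adjoint U * X) = X"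
proof -
  note aU = mat_adjoint_carrier[OF U(1)]
  have "mat_adjoint U * U = 1\<^sub>m n" "U * mat_adjoint U = 1\<^sub>m n"
    using U by (auto simp: unitary_mat_def)
  then show "mat_adjoint U * (U * X) = X" "U * (mat_adjoint U * X) = X"
    using assoc_mult_mat[OF aU U(1) X] assoc_mult_mat[OF U(1) aU X] X by auto
qed

lemma functional_calculus_unique:
  fixes d e :: "nat \<Rightarrow> real" and f :: "real \<Rightarrow> real"
  assumes U: "U \<in> carrier_mat n n" "unitary_mat U" and V: "V \<in> carrier_mat n n" "unitary_mat V"
    and eq: "U * mat_diag n (\<lambda>i. complex_of_real (d i)) * mat_adjoint U
           = V * mat_diag n (\<lambda>i. complex_of_real (e i)) * mat_adjoint V"
  shows "U * mat_diag n (\<lambda>i. complex_of_real (f (d i))) * mat_adjoint U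
       = V * mat_diag n (\<lambda>i. complex_of_real (f (e i))) * mat_adjoint V"
proof -
  note aU = mat_adjoint_carrier[OF U(1)] and aV = mat_adjoint_carrier[OF V(1)]
  define W where "W = mat_adjoint V * U"
  define D where "D g = mat_diag n (\<lambda>i. complex_of_real (g (d i)))" for g :: "real \<Rightarrow> real"
  define E where "E g = mat_diag n (\<lambda>i. complex_of_real (g (e i)))" for g :: "real \<Rightarrow> real"
  have D: "D g \<in> carrier_mat n n" and E: "E g \<in> carrier_mat n n" for g
    by (auto simp: D_def E_def)
  have W: "W \<in> carrier_mat n n" using aV U by (auto simp: W_def)
  have iff: "U * D g * mat_adjoint U = V * E g * mat_adjoint V \<longleftrightarrow> W * D g = E g * W" for g
  proof
    assume h: "U * D g * mat_adjoint U = V * E g * mat_adjoint V"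
    have "W * D g = mat_adjoint V * (U * D g * mat_adjoint U) * U"
      using aU aV U V D[of g] unitary_conj_cancel[OF U]
      by (simp add: W_def assoc_mult_mat[of _ n n _ n _ n] unitary_mat_def)
    also have "\<dots> = E g * W"
      unfolding h using aU aV U V E[of g] unitary_conj_cancel[OF V]
      by (simp add: W_def assoc_mult_mat[of _ n n _ n _ n])
    finally show "W * D g = E g * W" .
  next
    assume h: "W * D g = E g * W"
    have "U * D g * mat_adjoint U = V * (W * D g) * mat_adjoint U"
      using aU aV U V D[of g] unitary_conj_cancel[OF V]
      by (simp add: W_def assoc_mult_mat[of _ n n _ n _ n])
    also have "\<dots> = V * E g * mat_adjoint V"
      unfolding h using aU aV U V E[of g] unitary_conj_cancel[OF U]
      by (simp add: W_def assoc_mult_mat[of _ n n _ n _ n] unitary_mat_def)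
    finally show "U * D g * mat_adjoint U = V * E g * mat_adjoint V" .
  qed
  have entry: "W * D g = E g * W \<longleftrightarrow>
      (\<forall>i<n. \<forall>j<n. W $$ (i, j) * complex_of_real (g (d j)) = complex_of_real (g (e i)) * W $$ (i, j))"
    for g
    unfolding D_def E_def mat_diag_mult_left[OF W] mat_diag_mult_right[OF W]
    by (auto simp: mat_eq_iff)
  have "W * D (\<lambda>x. x) = E (\<lambda>x. x) * W"
    using eq iff[of "\<lambda>x. x"] by (simp add: D_def E_def)
  then have *: "\<forall>i<n. \<forall>j<n. W $$ (i, j) * complex_of_real (d j) = complex_of_real (e i) * W $$ (i, j)"
    unfolding entry .
  have "W $$ (i, j) * complex_of_real (f (d j)) = complex_of_real (f (e i)) * W $$ (i, j)"
    if "i < n" "j < n" for i j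
  proof (cases "W $$ (i, j) = 0")
    case False
    have "W $$ (i, j) * complex_of_real (d j) = W $$ (i, j) * complex_of_real (e i)"
      using *[rule_format, OF that] by (simp only: mult.commute)
    then have "d j = e i" using False by (simp add: mult_cancel_left)
    then show ?thesis by (simp only: mult.commute)
  qed simp
  then have "W * D f = E f * W" unfolding entry by simp
  then show ?thesis using iff[of f] by (simp add: D_def E_def)
qed

lemma mat_log_eq:
  fixes d :: "nat \<Rightarrow> real"
  assumes U: "U \<in> carrier_mat n n" "unitary_mat U"
    and A: "A = U * mat_diag n (\<lambda>i. complex_of_real (d i)) * mat_adjoint U"
  shows "mat_log A = U * mat_diag n (\<lambda>i. complex_of_real (ln (d i))) * mat_adjoint U"
  unfolding mat_log_def
proof (rule the_equality)
  fix L
  assume "\<exists>m V (e :: nat \<Rightarrow> real). V \<in> carrier_mat m m \<and> unitary_mat V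
     \<and> A = V * mat_diag m (\<lambda>i. complex_of_real (e i)) * mat_adjoint V
     \<and> L = V * mat_diag m (\<lambda>i. complex_of_real (ln (e i))) * mat_adjoint V"
  then obtain m V and e :: "nat \<Rightarrow> real" where V: "V \<in> carrier_mat m m" "unitary_mat V"
    and A': "A = V * mat_diag m (\<lambda>i. complex_of_real (e i)) * mat_adjoint V"
    and L: "L = V * mat_diag m (\<lambda>i. complex_of_real (ln (e i))) * mat_adjoint V"
    by blast
  have "dim_row A = n" unfolding A using U by simp
  moreover have "dim_row A = m" unfolding A' using V by simp
  ultimately have "m = n" by simp
  then show "L = U * mat_diag n (\<lambda>i. complex_of_real (ln (d i))) * mat_adjoint U"
    using functional_calculus_unique[OF U, of V d e ln] V A A' L by simp
next
  show "\<exists>m V (e :: nat \<Rightarrow> real). V \<in> carrier_mat m m \<and> unitary_mat V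
     \<and> A = V * mat_diag m (\<lambda>i. complex_of_real (e i)) * mat_adjoint V
     \<and> U * mat_diag n (\<lambda>i. complex_of_real (ln (d i))) * mat_adjoint U
       = V * mat_diag m (\<lambda>i. complex_of_real (ln (e i))) * mat_adjoint V"
    by (intro exI conjI, rule U(1), rule U(2), rule A, rule refl)
qed

end

theory Submission
  imports Defs "HOL-Real_Asymp.Real_Asymp"
begin

text \<open>
  Let the eigenvalues of \<open>H\<close> be \<open>0\<close> and \<open>n - 1\<close> further ones in \<open>[a ln n, b ln n]\<close>, and let
  \<open>Z = \<Sum> exp (- \<tau> \<lambda>)\<close>. The entropy of the Gibbs state is
  \<open>ln Z + \<tau> / Z \<cdot> \<Sum> \<lambda> exp (- \<tau> \<lambda>)\<close> (\<open>vn_entropy_gibbs_state\<close>).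

  The second summand is nonnegative, hence the entropy is at least
  \<open>ln Z \<ge> ln (1 + (n - 1) n\<^bsup>-\<tau>b\<^esup>)\<close>. For \<open>\<tau> b < 1\<close> the argument is at least \<open>n\<^bsup>1-\<tau>b\<^esup>\<close>; for
  \<open>\<tau> b = 1\<close> it equals \<open>2 - 1/n\<close>. Conversely \<open>Z \<ge> 1\<close> and \<open>ln Z \<le> Z - 1\<close> bound the entropy
  above by \<open>(n - 1) n\<^bsup>-\<tau>a\<^esup> (1 + \<tau> b ln n)\<close>, which tends to zero when \<open>\<tau> a > 1\<close>. Both bounds are
  \<open>gibbs_entropy_log_gap\<close>.

  The entropy formula rests on the spectral theorem \<open>hermitian_diagonalisation\<close>: in the form
  \<open>U D U\<^sup>*\<close> the exponential, the logarithm and the trace are computed on the diagonal, and the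
  diagonal of \<open>D\<close> is the multiset of roots of the characteristic polynomial.
\<close>

section \<open>Adjoints and unitary matrices\<close>

lemma adjoint_index:
  fixes A :: "complex mat"
  assumes "i < dim_col A" "j < dim_row A"
  shows "mat_adjoint A $$ (i, j) = cnj (A $$ (j, i))"
  using assms by (auto simp: mat_adjoint_def mat_of_rows_def conjugate_vec_def)

lemma adjoint_dim [simp]:
  fixes A :: "complex mat"
  shows "dim_row (mat_adjoint A) = dim_col A" "dim_col (mat_adjoint A) = dim_row A"
  by (auto simp: mat_adjoint_def mat_of_rows_def)

lemma adjoint_adjoint [simp]: "mat_adjoint (mat_adjoint A) = (A :: complex mat)"
  by (rule eq_matI) (auto simp: adjoint_index)

lemma adjoint_mult:
  fixes A B :: "complex mat"
  assumes "dim_col A = dim_row B"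
  shows "mat_adjoint (A * B) = mat_adjoint B * mat_adjoint A"
  using assms
  by (intro eq_matI)
     (auto simp: adjoint_index scalar_prod_def mult.commute intro!: sum.cong)

lemma unitary_matI:
  assumes "U \<in> carrier_mat n n" "mat_adjoint U * U = 1\<^sub>m n"
  shows "unitary_mat U"
  using assms mat_mult_left_right_inverse[OF mat_adjoint_carrier[OF assms(1)] assms(1)]
  by (auto simp: unitary_mat_def)

lemma unitary_mult:
  assumes "U \<in> carrier_mat n n" "V \<in> carrier_mat n n" "unitary_mat U" "unitary_mat V"
  shows "unitary_mat (U * V)"
proof (rule unitary_matI)
  note c = assms(1,2) mat_adjoint_carrier[OF assms(1)] mat_adjoint_carrier[OF assms(2)]
  have "mat_adjoint (U * V) * (U * V) = mat_adjoint V * (mat_adjoint U * (U * V))"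
    using c by (simp add: adjoint_mult assoc_mult_mat[of _ n n _ n _ n])
  also have "\<dots> = 1\<^sub>m n"
    using unitary_conj_cancel(1)[OF assms(1,3,2)] assms by (auto simp: unitary_mat_def)
  finally show "mat_adjoint (U * V) * (U * V) = 1\<^sub>m n" .
qed (use assms in auto)

text \<open>Gram--Schmidt started at \<open>v\<close> keeps \<open>v\<close> as its first vector; the columns of \<open>W\<close> are the
  resulting orthogonal vectors, normalised.\<close>

lemma unitary_first_column:
  fixes v :: "complex vec"
  assumes v: "v \<in> carrier_vec n" "v \<noteq> 0\<^sub>v n"
  obtains W c where "W \<in> carrier_mat n n" "unitary_mat W" "col W 0 = c \<cdot>\<^sub>v v"
proof -
  interpret cof_vec_space n "TYPE(complex)" .
  define b where "b = basis_completion v"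
  define ws where "ws = gram_schmidt n b"
  from basis_completion[OF v, folded b_def]
  have dist_b: "distinct b" and indep: "\<not> lin_dep (set b)" and b: "set b \<subseteq> carrier_vec n"
    and hdb: "hd b = v" and len_b: "length b = n" by auto
  have n: "n \<noteq> 0" using v by (metis carrier_vecD eq_vecI index_zero_vec(2) less_zeroE)
  then obtain vs where bv: "b = v # vs" using hdb len_b by (cases b) auto
  from gram_schmidt_result[OF b dist_b indep refl, folded ws_def]
  have ws: "set ws \<subseteq> carrier_vec n" "corthogonal ws" "length ws = n"
    by (auto simp: len_b)
  have "hd ws = v" using gram_schmidt_hd[OF v(1), of vs] bv ws_def by simp
  then have ws0: "ws ! 0 = v" using ws n by (cases ws) auto
  define r where "r j = sqrt (Re (ws ! j \<bullet>c ws ! j))" for j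
  define W where "W = mat n n (\<lambda>(i, j). ws ! j $ i / complex_of_real (r j))"
  have W: "W \<in> carrier_mat n n" by (simp add: W_def)
  have cv: "ws ! j \<in> carrier_vec n" if "j < n" for j using ws that by auto
  have ip: "ws ! i \<bullet>c ws ! j = (\<Sum>k<n. ws ! i $ k * cnj (ws ! j $ k))" if "i < n" "j < n" for i j
    using cv[OF that(1)] cv[OF that(2)] by (simp add: scalar_prod_def atLeast0LessThan)
  have rr: "complex_of_real (r j) * complex_of_real (r j) = ws ! j \<bullet>c ws ! j"
    "r j \<noteq> 0" if "j < n" for j
  proof -
    have eq: "ws ! j \<bullet>c ws ! j = complex_of_real (\<Sum>k<n. (cmod (ws ! j $ k))\<^sup>2)"
      unfolding ip[OF that that] by (simp only: complex_norm_square of_real_sum)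
    moreover have "ws ! j \<bullet>c ws ! j \<noteq> 0" using corthogonalD[OF ws(2), of j j] ws that by simp
    moreover have "(\<Sum>k<n. (cmod (ws ! j $ k))\<^sup>2) \<ge> 0" by (intro sum_nonneg) auto
    ultimately show "r j \<noteq> 0" "complex_of_real (r j) * complex_of_real (r j) = ws ! j \<bullet>c ws ! j"
      unfolding r_def eq by (simp_all only: Re_complex_of_real of_real_eq_0_iff real_sqrt_eq_zero_cancel_iff
        real_sqrt_mult_self abs_of_nonneg simp_thms not_False_eq_True flip: of_real_mult)
  qed
  have "mat_adjoint W * W = 1\<^sub>m n"
  proof (rule eq_matI)
    fix i j assume "i < dim_row (1\<^sub>m n :: complex mat)" "j < dim_col (1\<^sub>m n :: complex mat)"
    then have ij: "i < n" "j < n" by auto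
    have "(mat_adjoint W * W) $$ (i, j) = (\<Sum>k<n. cnj (W $$ (k, i)) * W $$ (k, j))"
      using ij W by (simp add: scalar_prod_def adjoint_index atLeast0LessThan)
    also have "\<dots> = (\<Sum>k<n. ws ! j $ k * cnj (ws ! i $ k)) / (complex_of_real (r i) * complex_of_real (r j))"
      using ij by (simp add: W_def sum_divide_distrib mult.commute)
    also have "\<dots> = (ws ! j \<bullet>c ws ! i) / (complex_of_real (r i) * complex_of_real (r j))"
      using ip[of j i] ij by simp
    also have "\<dots> = (if i = j then 1 else 0)"
    proof (cases "i = j")
      case True
      then show ?thesis using rr[OF ij(1)] by (metis divide_self mult_eq_0_iff of_real_eq_0_iff)
    next
      case False
      then show ?thesis using corthogonalD[OF ws(2), of j i] ws ij by simp
    qed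
    finally show "(mat_adjoint W * W) $$ (i, j) = 1\<^sub>m n $$ (i, j)" using ij by simp
  qed (use W in auto)
  then have "unitary_mat W" by (rule unitary_matI[OF W])
  moreover have "col W 0 = (1 / complex_of_real (r 0)) \<cdot>\<^sub>v v"
    using n v W by (intro eq_vecI) (auto simp: W_def ws0)
  ultimately show ?thesis using that W by blast
qed

section \<open>The spectral theorem for Hermitian matrices\<close>

text \<open>The diagonal is a function of the index, so that for fixed \<open>U\<close> the scalar multiple, product,
  exponential and logarithm of such matrices act on that function pointwise.\<close>

abbreviation unitary_diag :: "nat \<Rightarrow> complex mat \<Rightarrow> (nat \<Rightarrow> real) \<Rightarrow> complex mat" where
  "unitary_diag n U d \<equiv> U * mat_diag n (\<lambda>i. complex_of_real (d i)) * mat_adjoint U"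

lemma conj_diag_index:
  assumes "U \<in> carrier_mat n n" "i < n" "j < n"
  shows "(U * mat_diag n f * mat_adjoint U) $$ (i, j) = (\<Sum>l<n. U $$ (i, l) * f l * cnj (U $$ (j, l)))"
  using assms
  by (subst mat_diag_mult_right[OF assms(1)])
     (auto simp: scalar_prod_def adjoint_index atLeast0LessThan intro!: sum.cong)

text \<open>The induction step once an eigenvector has been moved to the first coordinate: a
  first column that vanishes below the diagonal has, by symmetry, a mirror image in the first
  row, so the matrix splits into a real scalar and a Hermitian block \<open>B\<close>. A diagonalisation
  of \<open>B\<close> is bordered by \<open>1\<close>.\<close>

lemma hermitian_diagonalisation_block:
  fixes A :: "complex mat"
  assumes A: "A \<in> carrier_mat (Suc n) (Suc n)" "mat_adjoint A = A"
    and col: "\<And>i. i < n \<Longrightarrow> A $$ (Suc i, 0) = 0"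
    and IH: "\<And>B :: complex mat. B \<in> carrier_mat n n \<Longrightarrow> mat_adjoint B = B \<Longrightarrow>
      \<exists>U d. U \<in> carrier_mat n n \<and> unitary_mat U \<and> B = unitary_diag n U d"
  shows "\<exists>U d. U \<in> carrier_mat (Suc n) (Suc n) \<and> unitary_mat U \<and> A = unitary_diag (Suc n) U d"
proof -
  have sym: "A $$ (i, j) = cnj (A $$ (j, i))" if "i < Suc n" "j < Suc n" for i j
    using adjoint_index[of i A j] A that by simp
  define B where "B = mat n n (\<lambda>(i, j). A $$ (Suc i, Suc j))"
  have B: "B \<in> carrier_mat n n" by (simp add: B_def)
  moreover have "mat_adjoint B = B"
    by (rule eq_matI) (auto simp: B_def adjoint_index intro: sym[symmetric])
  ultimately obtain P d where P: "P \<in> carrier_mat n n" "unitary_mat P" "B = unitary_diag n P d"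
    using IH by blast
  define U where "U = mat (Suc n) (Suc n) (\<lambda>(i, j). case (i, j) of
    (0, 0) \<Rightarrow> 1 | (Suc i, Suc j) \<Rightarrow> P $$ (i, j) | _ \<Rightarrow> (0 :: complex))"
  have U: "U \<in> carrier_mat (Suc n) (Suc n)" by (simp add: U_def)
  have Ui: "U $$ (0, 0) = 1" "j < n \<Longrightarrow> U $$ (0, Suc j) = 0" "j < n \<Longrightarrow> U $$ (Suc j, 0) = 0"
     "i < n \<Longrightarrow> j < n \<Longrightarrow> U $$ (Suc i, Suc j) = P $$ (i, j)" for i j
    by (auto simp: U_def)
  define d' where "d' = case_nat (Re (A $$ (0, 0))) d"
  have PP: "(\<Sum>k<n. cnj (P $$ (k, i)) * P $$ (k, j)) = (if i = j then 1 else 0)" if "i < n" "j < n" for i j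
  proof -
    have "(mat_adjoint P * P) $$ (i, j) = (\<Sum>k<n. cnj (P $$ (k, i)) * P $$ (k, j))"
      using that P by (simp add: scalar_prod_def adjoint_index atLeast0LessThan)
    from this[symmetric] show ?thesis
      using P that by (simp add: unitary_mat_def del: index_mult_mat)
  qed
  have "mat_adjoint U * U = 1\<^sub>m (Suc n)"
  proof (rule eq_matI)
    fix i j assume "i < dim_row (1\<^sub>m (Suc n) :: complex mat)" "j < dim_col (1\<^sub>m (Suc n) :: complex mat)"
    then have ij: "i < Suc n" "j < Suc n" by auto
    have "(mat_adjoint U * U) $$ (i, j) = (\<Sum>k<Suc n. cnj (U $$ (k, i)) * U $$ (k, j))"
      using ij U by (simp add: scalar_prod_def adjoint_index atLeast0LessThan)
    also have "\<dots> = (if i = j then 1 else 0)"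
      unfolding sum.lessThan_Suc_shift using ij
      by (cases i; cases j) (simp_all add: Ui PP)
    finally show "(mat_adjoint U * U) $$ (i, j) = 1\<^sub>m (Suc n) $$ (i, j)" using ij by simp
  qed (use U in auto)
  then have uU: "unitary_mat U" by (rule unitary_matI[OF U])
  have "A = unitary_diag (Suc n) U d'"
  proof (rule eq_matI)
    fix i j assume "i < dim_row (unitary_diag (Suc n) U d')" "j < dim_col (unitary_diag (Suc n) U d')"
    then have ij: "i < Suc n" "j < Suc n" using U by auto
    have Re0: "complex_of_real (Re (A $$ (0, 0))) = A $$ (0, 0)"
      using sym[of 0 0] by (metis Reals_cnj_iff of_real_Re zero_less_Suc)
    have row: "A $$ (0, Suc k) = 0" if "k < n" for k using sym[of 0 "Suc k"] col[OF that] that by simp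
    have Bi: "A $$ (Suc k, Suc l) = (\<Sum>m<n. P $$ (k, m) * complex_of_real (d m) * cnj (P $$ (l, m)))"
      if "k < n" "l < n" for k l
      unfolding conj_diag_index[OF P(1) that, symmetric] P(3)[symmetric] by (simp add: B_def that)
    show "A $$ (i, j) = unitary_diag (Suc n) U d' $$ (i, j)"
      unfolding conj_diag_index[OF U ij] sum.lessThan_Suc_shift using ij
      by (cases i; cases j) (simp_all add: Ui d'_def Re0 row col Bi)
  qed (use U A in auto)
  then show ?thesis using U uU by blast
qed

text \<open>The spectral theorem, by induction on the dimension: an eigenvector exists over the
  complex numbers, and conjugating by a unitary matrix with that eigenvector as first column
  produces the block form.\<close>

theorem hermitian_diagonalisation:
  fixes A :: "complex mat"
  assumes "A \<in> carrier_mat n n" "mat_adjoint A = A"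
  shows "\<exists>U d. U \<in> carrier_mat n n \<and> unitary_mat U \<and> A = unitary_diag n U d"
  using assms
proof (induction n arbitrary: A)
  case 0
  then show ?case
    by (intro exI[of _ "1\<^sub>m 0"] exI[of _ "\<lambda>_. 0"]) (auto simp: unitary_mat_def intro!: eq_matI)
next
  case (Suc n)
  note A = Suc.prems
  have "degree (char_poly A) = Suc n" using degree_monic_char_poly[OF A(1)] by simp
  then obtain e where "poly (char_poly A) e = 0"
    using fundamental_theorem_of_algebra[of "char_poly A"] by (auto simp: constant_degree)
  then have "eigenvalue A e" using eigenvalue_root_char_poly[OF A(1)] by simp
  then obtain v where v: "v \<in> carrier_vec (Suc n)" "v \<noteq> 0\<^sub>v (Suc n)" "A *\<^sub>v v = e \<cdot>\<^sub>v v"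
    using A by (auto simp: eigenvalue_def eigenvector_def)
  obtain W c where W: "W \<in> carrier_mat (Suc n) (Suc n)" "unitary_mat W" "col W 0 = c \<cdot>\<^sub>v v"
    using unitary_first_column[OF v(1,2)] .
  note aW = mat_adjoint_carrier[OF W(1)]
  define A' where "A' = mat_adjoint W * (A * W)"
  have A': "A' \<in> carrier_mat (Suc n) (Suc n)" using aW A W by (auto simp: A'_def)
  have "mat_adjoint A' = A'"
    using A W aW by (simp add: A'_def adjoint_mult assoc_mult_mat[of _ "Suc n" "Suc n" _ "Suc n" _ "Suc n"])
  moreover have "A' $$ (Suc i, 0) = 0" if "i < n" for i
  proof -
    have "col (A * W) 0 = A *\<^sub>v (c \<cdot>\<^sub>v v)" 
      unfolding col_mult2[OF A(1) W(1) zero_less_Suc] W(3) by (rule refl)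
    also have "\<dots> = e \<cdot>\<^sub>v col W 0" using A v W by (simp add: mult_mat_vec smult_smult_assoc mult.commute)
    finally have "A' $$ (Suc i, 0) = row (mat_adjoint W) (Suc i) \<bullet> (e \<cdot>\<^sub>v col W 0)"
      using that A W aW by (simp add: A'_def)
    also have "\<dots> = e * (mat_adjoint W * W) $$ (Suc i, 0)"
      using that W(1) aW by simp
    also have "\<dots> = 0" using W that by (simp add: unitary_mat_def)
    finally show ?thesis .
  qed
  ultimately obtain U d where U: "U \<in> carrier_mat (Suc n) (Suc n)" "unitary_mat U"
    "A' = unitary_diag (Suc n) U d"
    using hermitian_diagonalisation_block[OF A' _ _ Suc.IH] by blast
  note aU = mat_adjoint_carrier[OF U(1)]
  define D where "D = mat_diag (Suc n) (\<lambda>i. complex_of_real (d i))"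
  have D: "D \<in> carrier_mat (Suc n) (Suc n)" by (simp add: D_def)
  have "A = W * A' * mat_adjoint W"
    using A W aW unitary_conj_cancel[OF W(1,2)]
    by (simp add: A'_def assoc_mult_mat[of _ "Suc n" "Suc n" _ "Suc n" _ "Suc n"] unitary_mat_def)
  also have "\<dots> = unitary_diag (Suc n) (W * U) d"
    unfolding U(3) D_def[symmetric] using W(1) U(1) aW aU D
    by (simp add: adjoint_mult assoc_mult_mat[of _ "Suc n" "Suc n" _ "Suc n" _ "Suc n"])
  finally show ?case using unitary_mult[OF W(1) U(1) W(2) U(2)] W U
    by (metis mult_carrier_mat)
qed

section \<open>Functional calculus and the entropy of a Gibbs state\<close>

lemma unitary_diag_similar:
  assumes "U \<in> carrier_mat n n" "unitary_mat U"
  shows "similar_mat_wit (U * mat_diag n f * mat_adjoint U) (mat_diag n f) U (mat_adjoint U)"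
proof (rule similar_mat_witI[of _ _ n])
  note c = assms(1) mat_diag_dim[of n f] mat_adjoint_carrier[OF assms(1)]
  show "U * mat_diag n f * mat_adjoint U \<in> carrier_mat n n"
    by (intro mult_carrier_mat[of _ n n] c)
qed (use assms mat_adjoint_carrier[OF assms(1)] in \<open>auto simp: unitary_mat_def\<close>)

lemma smult_unitary_diag:
  assumes "U \<in> carrier_mat n n"
  shows "complex_of_real c \<cdot>\<^sub>m unitary_diag n U d = unitary_diag n U (\<lambda>i. c * d i)"
  using assms
  by (intro eq_matI) (simp_all add: conj_diag_index sum_distrib_left mult_ac del: index_mult_mat(1))

lemma mult_unitary_diag:
  assumes U: "U \<in> carrier_mat n n" "unitary_mat U"
  shows "unitary_diag n U d * unitary_diag n U e = unitary_diag n U (\<lambda>i. d i * e i)"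
proof -
  define D where "D = mat_diag n (\<lambda>i. complex_of_real (d i))"
  define E where "E = mat_diag n (\<lambda>i. complex_of_real (e i))"
  have c: "D \<in> carrier_mat n n" "E \<in> carrier_mat n n" by (auto simp: D_def E_def)
  have DE: "mat_diag n (\<lambda>i. complex_of_real (d i * e i)) = D * E" by (simp add: D_def E_def)
  show ?thesis
    unfolding DE D_def[symmetric] E_def[symmetric]
    using U(1) mat_adjoint_carrier[OF U(1)] c unitary_conj_cancel[OF U]
    by (simp add: assoc_mult_mat[of _ n n _ n _ n])
qed

text \<open>The squared moduli in each column of a unitary matrix add up to one, so summing
  the diagonal entries \<open>\<Sum>l. U\<^sub>i\<^sub>l d\<^sub>l cnj U\<^sub>i\<^sub>l\<close> over \<open>i\<close> first leaves the sum of the \<open>d\<^sub>l\<close>.\<close>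

lemma trace_unitary_diag:
  assumes U: "U \<in> carrier_mat n n" "unitary_mat U"
  shows "mat_trace (unitary_diag n U d) = complex_of_real (\<Sum>i<n. d i)"
proof -
  have col: "(\<Sum>i<n. U $$ (i, l) * cnj (U $$ (i, l))) = 1" if "l < n" for l
  proof -
    have "(\<Sum>i<n. U $$ (i, l) * cnj (U $$ (i, l))) = (mat_adjoint U * U) $$ (l, l)"
      using that U by (simp add: scalar_prod_def adjoint_index atLeast0LessThan mult.commute)
    also have "\<dots> = 1" using U that by (simp add: unitary_mat_def del: index_mult_mat)
    finally show ?thesis .
  qed
  have "mat_trace (unitary_diag n U d)
      = (\<Sum>i<n. \<Sum>l<n. U $$ (i, l) * complex_of_real (d l) * cnj (U $$ (i, l)))"
    using U by (simp add: mat_trace_def conj_diag_index del: index_mult_mat(1))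
  also have "\<dots> = (\<Sum>l<n. complex_of_real (d l) * (\<Sum>i<n. U $$ (i, l) * cnj (U $$ (i, l))))"
    by (subst sum.swap) (simp add: sum_distrib_left mult_ac)
  also have "\<dots> = complex_of_real (\<Sum>i<n. d i)" by (simp add: col)
  finally show ?thesis .
qed

lemma mat_diag_pow: "mat_diag n f ^\<^sub>m k = mat_diag n (\<lambda>i. f i ^ k :: 'a :: comm_semiring_1)"
proof (induction k)
  case 0
  show ?case using mat_diag_dim[of n f] by (simp add: mat_diag_def)
qed (simp add: mult.commute)

text \<open>Powers commute with conjugation by \<open>U\<close>, so each entry of the exponential series is a
  finite linear combination of scalar exponential series and may be summed termwise.\<close>

lemma mat_exp_unitary_diag:
  assumes U: "U \<in> carrier_mat n n" "unitary_mat U"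
  shows "mat_exp (unitary_diag n U d) = unitary_diag n U (\<lambda>i. exp (d i))"
proof (rule eq_matI)
  fix i j
  assume "i < dim_row (unitary_diag n U (\<lambda>i. exp (d i)))"
    and "j < dim_col (unitary_diag n U (\<lambda>i. exp (d i)))"
  then have ij: "i < n" "j < n" using U by auto
  have pow: "unitary_diag n U d ^\<^sub>m k = unitary_diag n U (\<lambda>i. d i ^ k)" for k
    using similar_mat_wit_pow_id[OF unitary_diag_similar[OF U, of "\<lambda>i. complex_of_real (d i)"], of k]
    by (simp add: mat_diag_pow)
  have "(\<lambda>k. \<Sum>l<n. U $$ (i, l) * (complex_of_real (d l) ^ k /\<^sub>R fact k) * cnj (U $$ (j, l)))
      sums (\<Sum>l<n. U $$ (i, l) * exp (complex_of_real (d l)) * cnj (U $$ (j, l)))"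
    by (intro sums_sum sums_mult sums_mult2 exp_converges)
  moreover have "(unitary_diag n U d ^\<^sub>m k) $$ (i, j) / of_nat (fact k)
      = (\<Sum>l<n. U $$ (i, l) * (complex_of_real (d l) ^ k /\<^sub>R fact k) * cnj (U $$ (j, l)))" for k
    unfolding pow conj_diag_index[OF U(1) ij]
    by (simp add: sum_divide_distrib scaleR_conv_of_real field_simps)
  ultimately show "mat_exp (unitary_diag n U d) $$ (i, j) = unitary_diag n U (\<lambda>i. exp (d i)) $$ (i, j)"
    unfolding conj_diag_index[OF U(1) ij] using ij U(1)
    by (simp add: mat_exp_def sums_iff exp_of_real)
qed (use U in \<open>auto simp: mat_exp_def\<close>)

text \<open>The Gibbs state has eigenvalues \<open>p\<^sub>i = exp (- \<tau> d\<^sub>i) / Z\<close>. Since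
  \<open>ln p\<^sub>i = - \<tau> d\<^sub>i - ln Z\<close> and the \<open>p\<^sub>i\<close> sum to one, the entropy is the thermodynamic
  expression \<open>ln Z\<close> plus \<open>\<tau>\<close> times the mean energy.\<close>

lemma vn_entropy_gibbs_unitary_diag:
  fixes d :: "nat \<Rightarrow> real" and \<tau> :: real
  assumes U: "U \<in> carrier_mat n n" "unitary_mat U" and n: "n > 0"
  defines "Z \<equiv> \<Sum>i<n. exp (- \<tau> * d i)"
  shows "vn_entropy (gibbs_state (unitary_diag n U d) \<tau>)
       = ln Z + \<tau> * (\<Sum>i<n. d i * exp (- \<tau> * d i)) / Z"
proof -
  have Z: "Z > 0" unfolding Z_def using n by (intro sum_pos) auto
  define p where "p i = exp (- \<tau> * d i) / Z" for i
  have "gibbs_state (unitary_diag n U d) \<tau>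
      = complex_of_real (1 / Z) \<cdot>\<^sub>m unitary_diag n U (\<lambda>i. exp (- \<tau> * d i))"
    unfolding gibbs_state_def smult_unitary_diag[OF U(1), of "- \<tau>"] mat_exp_unitary_diag[OF U]
      trace_unitary_diag[OF U] Z_def by (simp only: of_real_divide of_real_1)
  also have "\<dots> = unitary_diag n U p"
    unfolding smult_unitary_diag[OF U(1)] p_def by simp
  finally have G: "gibbs_state (unitary_diag n U d) \<tau> = unitary_diag n U p" .
  have lnp: "ln (p i) = - \<tau> * d i - ln Z" for i
    using Z by (simp add: p_def ln_div)
  have sum_p: "(\<Sum>i<n. p i) = 1"
    using Z by (simp add: p_def Z_def flip: sum_divide_distrib)
  have "vn_entropy (gibbs_state (unitary_diag n U d) \<tau>) = - (\<Sum>i<n. p i * ln (p i))"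
    unfolding G vn_entropy_def mat_log_eq[OF U refl] mult_unitary_diag[OF U] trace_unitary_diag[OF U]
    by simp
  also have "\<dots> = \<tau> * (\<Sum>i<n. d i * p i) + ln Z * (\<Sum>i<n. p i)"
    unfolding lnp by (simp add: algebra_simps sum.distrib sum_distrib_left sum_negf sum_subtractf)
  also have "(\<Sum>i<n. d i * p i) = (\<Sum>i<n. d i * exp (- \<tau> * d i)) / Z"
    by (simp add: p_def sum_divide_distrib)
  finally show ?thesis by (simp add: sum_p)
qed

section \<open>Entropy as a function of the spectrum\<close>

text \<open>The multiset whose decreasing enumeration is \<^const>\<open>eigval\<close>. Working with it
  makes the entropy formula independent of the order in which a diagonalisation lists the
  eigenvalues.\<close>

definition real_spectrum :: "complex mat \<Rightarrow> real multiset" where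
  "real_spectrum A = image_mset Re (proots (char_poly A))"

lemma real_spectrum_unitary_diag:
  assumes U: "U \<in> carrier_mat n n" "unitary_mat U"
  shows "real_spectrum (unitary_diag n U d) = image_mset d (mset_set {..<n})"
proof -
  define D where "D = mat_diag n (\<lambda>i. complex_of_real (d i))"
  have "similar_mat (unitary_diag n U d) D"
    using unitary_diag_similar[OF U] by (auto simp: similar_mat_def D_def)
  then have "char_poly (unitary_diag n U d) = char_poly D" by (rule char_poly_similar)
  also have "\<dots> = (\<Prod>x\<leftarrow>diag_mat D. [:- x, 1:])"
    by (rule char_poly_upper_triangular[of _ n]) (auto simp: D_def mat_diag_def)
  also have "diag_mat D = map (\<lambda>i. complex_of_real (d i)) [0..<n]"
    by (auto simp: diag_mat_def D_def mat_diag_def)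
  finally have "char_poly (unitary_diag n U d) = (\<Prod>i\<leftarrow>[0..<n]. [:- complex_of_real (d i), 1:])"
    by (simp add: o_def)
  also have "\<dots> = (\<Prod>i<n. [:- complex_of_real (d i), 1:])"
    by (simp add: prod.list_conv_set_nth atLeast0LessThan)
  finally have "proots (char_poly (unitary_diag n U d)) = (\<Sum>i<n. {#complex_of_real (d i)#})"
    by (simp add: proots_prod)
  then show ?thesis
    by (simp add: real_spectrum_def sum_unfold_sum_mset multiset.map_comp o_def flip: image_mset.compositionality)
qed

definition partition_sum :: "real \<Rightarrow> real multiset \<Rightarrow> real" where
  "partition_sum \<tau> M = (\<Sum>x\<in>#M. exp (- \<tau> * x))"

definition energy_sum :: "real \<Rightarrow> real multiset \<Rightarrow> real" where
  "energy_sum \<tau> M = (\<Sum>x\<in>#M. x * exp (- \<tau> * x))"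

text \<open>The bridge from matrices to numbers: after this the entropy depends only on the
  multiset of eigenvalues.\<close>

theorem vn_entropy_gibbs_state:
  assumes A: "A \<in> carrier_mat n n" "hermitian_mat A" and n: "n > 0"
  shows "vn_entropy (gibbs_state A \<tau>)
       = ln (partition_sum \<tau> (real_spectrum A))
         + \<tau> * energy_sum \<tau> (real_spectrum A) / partition_sum \<tau> (real_spectrum A)"
proof -
  obtain U d where U: "U \<in> carrier_mat n n" "unitary_mat U" and Ad: "A = unitary_diag n U d"
    using hermitian_diagonalisation[OF A(1)] A(2) by (auto simp: hermitian_mat_def)
  show ?thesis
    unfolding Ad real_spectrum_unitary_diag[OF U] vn_entropy_gibbs_unitary_diag[OF U n]
      partition_sum_def energy_sum_def
    by (simp add: sum_unfold_sum_mset multiset.map_comp o_def)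
qed

section \<open>Entropy bounds for a logarithmic spectral gap\<close>

text \<open>In increasing order, the entry in second place is \<open>l\<close>, the one in last place is \<open>u\<close>.
  All entries but the first are thus at least \<open>l > 0\<close>, which forces the eigenvalue \<open>0\<close> into
  first place.\<close>

lemma real_spectrum_gap:
  assumes A: "A \<in> carrier_mat n n" and n: "n \<ge> 2"
    and zero: "poly (char_poly A) 0 = 0"
    and l: "eigval A (n - 1) = l" "l > 0" and u: "eigval A 1 = u"
  obtains N where "real_spectrum A = add_mset 0 N" "size N = n - 1" "set_mset N \<subseteq> {l..u}"
proof -
  define xs where "xs = sorted_list_of_multiset (real_spectrum A)"
  have sorted: "sorted xs" and mset: "mset xs = real_spectrum A" by (auto simp: xs_def)
  have cp: "degree (char_poly A) = n" "char_poly A \<noteq> 0" using degree_monic_char_poly[OF A] n by auto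
  have "size (real_spectrum A) = n"
    using cp by (simp add: real_spectrum_def size_proots_complex)
  then have len: "length xs = n" using mset by (metis size_mset)
  have "eigval A k = rev xs ! (k - 1)" for k
    by (simp add: eigval_def xs_def real_spectrum_def)
  then have xl: "xs ! 1 = l" and xu: "xs ! (n - 1) = u"
    using l(1) u n len by (auto simp: rev_nth Suc_diff_Suc numeral_2_eq_2)
  obtain x ys where xs: "xs = x # ys" using len n by (cases xs) auto
  have ys: "l \<le> y \<and> y \<le> u" if y_in: "y \<in> set ys" for y
  proof -
    obtain i where i: "i < length ys" "y = ys ! i" using y_in by (auto simp: in_set_conv_nth)
    then have y: "y = xs ! Suc i" and "Suc i < n" using xs len by auto
    then show ?thesis
      using sorted_nth_mono[OF sorted, of 1 "Suc i"] sorted_nth_mono[OF sorted, of "Suc i" "n - 1"] len xl xu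
      by auto
  qed
  have "0 \<in># proots (char_poly A)" using zero cp by simp
  then have "0 \<in># real_spectrum A" unfolding real_spectrum_def
    by (metis image_eqI set_image_mset zero_complex.sel(1))
  then have "0 \<in> set xs" by (simp flip: mset)
  then have "x = 0" using ys l(2) xs by fastforce
  show ?thesis
    by (rule that[of "mset ys"]) (use mset xs \<open>x = 0\<close> len ys in auto)
qed

text \<open>The zero level contributes exactly \<open>1\<close> to \<open>Z\<close>, the other levels between
  \<open>exp (- \<tau> u)\<close> and \<open>exp (- \<tau> l)\<close> each. The lower bound drops the mean energy, which is
  nonnegative; the upper bound uses \<open>ln Z \<le> Z - 1\<close> and \<open>Z \<ge> 1\<close>.\<close>

lemma gibbs_entropy_bounds:
  fixes N :: "real multiset" and \<tau> l u :: real
  assumes range: "set_mset N \<subseteq> {l..u}" and l: "0 \<le> l" "l \<le> u" and \<tau>: "\<tau> > 0"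
  defines "Z \<equiv> partition_sum \<tau> (add_mset 0 N)" and "E \<equiv> energy_sum \<tau> (add_mset 0 N)"
  shows "ln (1 + size N * exp (- \<tau> * u)) \<le> ln Z + \<tau> * E / Z"
    and "ln Z + \<tau> * E / Z \<le> size N * exp (- \<tau> * l) * (1 + \<tau> * u)"
proof -
  have N: "l \<le> x \<and> x \<le> u" if "x \<in># N" for x using range that by auto
  have Z: "Z = 1 + (\<Sum>x\<in>#N. exp (- \<tau> * x))" by (simp add: Z_def partition_sum_def)
  have E: "E = (\<Sum>x\<in>#N. x * exp (- \<tau> * x))" by (simp add: E_def energy_sum_def)
  have "(\<Sum>x\<in>#N. exp (- \<tau> * u)) \<le> (\<Sum>x\<in>#N. exp (- \<tau> * x))"
    using N \<tau> by (intro sum_mset_mono) auto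
  then have Z_ge: "1 + size N * exp (- \<tau> * u) \<le> Z" unfolding Z by simp
  have "(\<Sum>x\<in>#N. exp (- \<tau> * x)) \<le> (\<Sum>x\<in>#N. exp (- \<tau> * l))"
    using N \<tau> by (intro sum_mset_mono) auto
  then have Z_le: "Z \<le> 1 + size N * exp (- \<tau> * l)" unfolding Z by simp
  have "(\<Sum>x\<in>#N. 0) \<le> E"
    unfolding E using N l by (intro sum_mset_mono) force
  then have E_ge: "0 \<le> E" by simp
  have "E \<le> (\<Sum>x\<in>#N. u * exp (- \<tau> * l))"
    unfolding E using N \<tau> l by (intro sum_mset_mono mult_mono) (auto dest!: N)
  then have E_le: "E \<le> size N * (u * exp (- \<tau> * l))" by simp
  have Z1: "Z \<ge> 1" using Z_ge by (smt (verit) exp_gt_zero mult_nonneg_nonneg of_nat_0_le_iff)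
  have "0 \<le> \<tau> * E / Z" using Z1 E_ge \<tau> by simp
  moreover have "ln (1 + size N * exp (- \<tau> * u)) \<le> ln Z"
    using Z_ge Z1 by (subst ln_le_cancel_iff) (auto intro: add_pos_nonneg)
  ultimately show "ln (1 + size N * exp (- \<tau> * u)) \<le> ln Z + \<tau> * E / Z" by linarith
  have "ln Z \<le> Z - 1" using Z1 by (intro ln_le_minus_one) auto
  moreover have "\<tau> * E / Z \<le> \<tau> * E" using Z1 E_ge \<tau> using frac_le[of "\<tau> * E" "\<tau> * E" 1 Z] by simp
  moreover have "\<tau> * E \<le> \<tau> * (size N * (u * exp (- \<tau> * l)))"
    using E_le \<tau> by simp
  ultimately have "ln Z + \<tau> * E / Z \<le> size N * exp (- \<tau> * l) + \<tau> * (size N * (u * exp (- \<tau> * l)))"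
    using Z_le by linarith
  then show "ln Z + \<tau> * E / Z \<le> size N * exp (- \<tau> * l) * (1 + \<tau> * u)"
    by (simp add: algebra_simps)
qed

text \<open>With energies at the scale \<open>ln n\<close>, Boltzmann weights become powers of \<open>n\<close> that
  compete with the number \<open>n - 1\<close> of excited levels.\<close>

lemma gibbs_entropy_log_gap:
  assumes A: "A \<in> carrier_mat n n" "hermitian_mat A" and n: "n \<ge> 2"
    and zero: "poly (char_poly A) 0 = 0" and \<tau>: "\<tau> > 0" and a: "a > 0"
    and ev: "eigval A (n - 1) = a * ln n" "eigval A 1 = b * ln n"
  shows "ln (1 + (real n - 1) * real n powr (- \<tau> * b)) \<le> vn_entropy (gibbs_state A \<tau>)"
    and "vn_entropy (gibbs_state A \<tau>) \<le> (real n - 1) * real n powr (- \<tau> * a) * (1 + \<tau> * b * ln n)"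
proof -
  have pos: "a * ln n > 0" using a n by simp
  obtain N where N: "real_spectrum A = add_mset 0 N" "size N = n - 1"
    "set_mset N \<subseteq> {a * ln n..b * ln n}"
    using real_spectrum_gap[OF A(1) n zero ev(1) pos ev(2)] by blast
  obtain x where "x \<in># N" using N(2) n by (cases N) auto
  then have le: "a * ln n \<le> b * ln n" using N(3) by force
  have pw: "exp (- \<tau> * (c * ln n)) = real n powr (- \<tau> * c)" for c
    using n by (simp add: powr_def)
  have S: "vn_entropy (gibbs_state A \<tau>) = ln (partition_sum \<tau> (add_mset 0 N))
      + \<tau> * energy_sum \<tau> (add_mset 0 N) / partition_sum \<tau> (add_mset 0 N)"
    using vn_entropy_gibbs_state[OF A] n N(1) by simp
  have size: "real (size N) = real n - 1" using N(2) n by simp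
  note bounds = gibbs_entropy_bounds[OF N(3) less_imp_le[OF pos] le \<tau>, unfolded size pw, folded S]
  show "ln (1 + (real n - 1) * real n powr (- \<tau> * b)) \<le> vn_entropy (gibbs_state A \<tau>)"
    using bounds(1) by simp
  show "vn_entropy (gibbs_state A \<tau>) \<le> (real n - 1) * real n powr (- \<tau> * a) * (1 + \<tau> * b * ln n)"
    using bounds(2) by (simp add: mult.assoc)
qed

theorem theorem10:
  fixes \<tau> a b :: real and H :: "nat \<Rightarrow> complex mat"
  assumes "\<tau> > 0" and "a > 0" and "b > 0"
    and "\<And>n. n \<ge> 1 \<Longrightarrow> H n \<in> carrier_mat n n"
    and "\<And>n. n \<ge> 1 \<Longrightarrow> psd_mat (H n)"
    and "\<And>n. n \<ge> 1 \<Longrightarrow> order 0 (char_poly (H n)) = 1"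
    and "\<forall>\<^sub>F n in sequentially.
           eigval (H n) (n - 1) = a * ln (real n) \<and> eigval (H n) 1 = b * ln (real n)"
  shows "(\<tau> < 1 / b \<longrightarrow>
            (\<exists>\<epsilon> :: nat \<Rightarrow> real. \<epsilon> \<longlonglongrightarrow> 0 \<and>
              (\<forall>\<^sub>F n in sequentially.
                 vn_entropy (gibbs_state (H n) \<tau>) \<ge> (1 - \<tau> * b) * ln (real n) + \<epsilon> n)))
       \<and> (\<tau> = 1 / b \<longrightarrow>
            (\<exists>\<epsilon> :: nat \<Rightarrow> real. \<epsilon> \<longlonglongrightarrow> 0 \<and>
              (\<forall>\<^sub>F n in sequentially.
                 vn_entropy (gibbs_state (H n) \<tau>) \<ge> ln 2 + \<epsilon> n)))
       \<and> (\<tau> > 1 / a \<longrightarrow> (\<lambda>n. vn_entropy (gibbs_state (H n) \<tau>)) \<longlonglongrightarrow> 0)"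
proof -
  let ?S = "\<lambda>n. vn_entropy (gibbs_state (H n) \<tau>)"
  have bounds: "\<forall>\<^sub>F n in sequentially. n \<ge> 2
      \<and> ln (1 + (real n - 1) * real n powr (- \<tau> * b)) \<le> ?S n
      \<and> ?S n \<le> (real n - 1) * real n powr (- \<tau> * a) * (1 + \<tau> * b * ln n)"
    using assms(7) eventually_ge_at_top[of 2]
  proof eventually_elim
    case (elim n)
    have "poly (char_poly (H n)) 0 = 0"
      using assms(6)[of n] elim by (auto simp: order_root)
    then show ?case
      using gibbs_entropy_log_gap[of "H n" n \<tau> a b] assms(1,2) assms(4,5)[of n] elim
      by (auto simp: psd_mat_def)
  qed
  have ge0: "\<forall>\<^sub>F n in sequentially. 0 \<le> ?S n"
    using bounds
  proof eventually_elim
    case (elim n)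
    have "0 \<le> ln (1 + (real n - 1) * real n powr (- \<tau> * b))" using elim by (intro ln_ge_zero) auto
    then show ?case using elim by linarith
  qed
  have part1: "\<forall>\<^sub>F n in sequentially. (1 - \<tau> * b) * ln (real n) + 0 \<le> ?S n"
    using bounds
  proof eventually_elim
    case (elim n)
    \<comment> \<open>As \<open>q \<le> 1\<close>, counting the zero level with weight \<open>q\<close> as well only lowers the partition sum.\<close>
    define q where "q = real n powr (- \<tau> * b)"
    have q: "0 < q" "q \<le> real n powr 0"
      unfolding q_def using elim assms by (auto intro!: powr_mono simp del: powr_zero_eq_one)
    then have "real n * q \<le> 1 + (real n - 1) * q" using elim by (simp add: algebra_simps)
    then have "ln (real n * q) \<le> ln (1 + (real n - 1) * q)"
      using q elim by (subst ln_le_cancel_iff) (auto intro: add_pos_nonneg)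
    moreover have "ln (real n * q) = (1 - \<tau> * b) * ln n"
      using elim by (simp add: q_def ln_mult ln_powr algebra_simps)
    ultimately show ?case using elim by (simp add: q_def)
  qed
  have part2: "\<exists>\<epsilon> :: nat \<Rightarrow> real. \<epsilon> \<longlonglongrightarrow> 0 \<and> (\<forall>\<^sub>F n in sequentially. ?S n \<ge> ln 2 + \<epsilon> n)"
    if "\<tau> = 1 / b"
  proof (intro exI conjI)
    show "(\<lambda>n. ln (2 - 1 / real n) - ln 2) \<longlonglongrightarrow> 0" by real_asymp
    show "\<forall>\<^sub>F n in sequentially. ?S n \<ge> ln 2 + (ln (2 - 1 / real n) - ln 2)"
      using bounds
    proof eventually_elim
      case (elim n)
      have "1 + (real n - 1) * real n powr (- \<tau> * b) = 2 - 1 / real n"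
        using elim that assms(3) by (simp add: powr_minus_divide field_simps)
      then show ?case using elim by simp
    qed
  qed
  have part3: "?S \<longlonglongrightarrow> 0" if "\<tau> > 1 / a"
  proof (rule tendsto_sandwich[OF ge0 _ tendsto_const])
    have "\<tau> * a > 1" using that assms(2) by (simp add: field_simps)
    moreover have "\<tau> * b > 0" using assms by simp
    ultimately have "(\<lambda>n. (real n - 1) * real n powr (- c) * (1 + d * ln n)) \<longlonglongrightarrow> 0"
      if "c = \<tau> * a" "d = \<tau> * b" for c d
      unfolding that(1)[symmetric] that(2)[symmetric] by real_asymp
    then show "(\<lambda>n. (real n - 1) * real n powr (- \<tau> * a) * (1 + \<tau> * b * ln n)) \<longlonglongrightarrow> 0"
      by simp
    show "\<forall>\<^sub>F n in sequentially. ?S n \<le> (real n - 1) * real n powr (- \<tau> * a) * (1 + \<tau> * b * ln n)"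
      using bounds by eventually_elim auto
  qed
  show ?thesis using part1 part2 part3 by (auto intro!: exI[of _ "\<lambda>_. 0"])
qed

end
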